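(* Let $(\mu^{(0)},(\mu^{(1)},r^{(1)}),\dots,(\mu^{(n)},r^{(n)}))$ be a rigged configuration for $A^{(1)}_n$ with $\mu^{(0)}=(\mu^{(0)}_1,\dots,\mu^{(0)}_L)$, and let $p_1\otimes\cdots\otimes p_L\in B_{\mu^{(0)}_1}\otimes\cdots\otimes B_{\mu^{(0)}_L}$ be its image under the KKR map. Then for every $1\le k\le L$, writing $p_k=(x_1,\dots,x_{n+1})$, one has for every $1\le d\le n+1$ $$x_d=\tau_{k,d}-\tau_{k-1,d}-\tau_{k,d-1}+\tau_{k-1,d-1},$$ where $\tau_{k,d}$ are the ultradiscrete tau functions of this rigged configuration.
   Context: Fix $n\ge1$. For $l\ge1$ let $B_l=\{x=(x_1,\dots,x_{n+1})\in\mathbb Z_{\ge0}^{n+1}: x_1+\cdots+x_{n+1}=l\}$ (an element $x$ is also viewed as a one-row semistandard tableau with $x_i$ letters $i$). Notation: for finite multisets (or sequences) of positive integers $\lambda=(\lambda_1,\dots,\lambda_k)$, $\mu=(\mu_1,\dots,\mu_m)$ write $|\lambda|=\sum_i\lambda_i$, $\lambda_{[N]}=(\lambda_1,\dots,\lambda_N)$ ($\lambda_{[0]}=\emptyset$), $\min(\lambda,\mu)=\sum_{i=1}^k\sum_{j=1}^m\min(\lambda_i,\mu_j)$, and $\lambda\subseteq\mu$ means inclusion of multisets (with multiplicity). Rigged configuration: data $(\mu^{(0)},(\mu^{(1)},r^{(1)}),\dots,(\mu^{(n)},r^{(n)}))$ where $\mu^{(0)}=(\mu^{(0)}_1,\dots,\mu^{(0)}_L)$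 is a sequence of positive integers and, for $1\le a\le n$, $(\mu^{(a)},r^{(a)})$ is a finite multiset of pairs $(\mu^{(a)}_i,r^{(a)}_i)$ (row length $\mu^{(a)}_i\in\mathbb Z_{\ge1}$, rigging $r^{(a)}_i\in\mathbb Z$) such that $0\le r^{(a)}_i\le p^{(a)}_{\mu^{(a)}_i}$, where the vacancy numbers are $p^{(a)}_j=E^{(a-1)}_j-2E^{(a)}_j+E^{(a+1)}_j$ with $E^{(a)}_j=\sum_k\min(j,\mu^{(a)}_k)$ for $0\le a\le n$ and $E^{(n+1)}_j=0$. Tau functions: for $\lambda\subseteq\mu^{(0)}$ and $1\le d\le n+1$, $$\tau_d(\lambda)=\max\Big\{\min(\lambda,\nu^{(1)})+\sum_{a=1}^{n-1}\min(\nu^{(a)},\nu^{(a+1)})-\sum_{a=1}^{n}\min(\nu^{(a)},\nu^{(a)})-\sum_{a=1}^n|s^{(a)}|-|\nu^{(d)}|\Big\},$$ the maximum being over all independent choices, for each $1\le a\le n$, of a sub-multiset of pairs $\{(\nu^{(a)}_i,s^{(a)}_i)\}\subseteq\{(\mu^{(a)}_i,r^{(a)}_i)\}$ (with $\nu^{(a)}$ the chosen lengths and $s^{(a)}$ the chosen riggings), and with the convention $|\nu^{(n+1)}|=0$; also $\tau_0(\lambda)=\tau_{n+1}(\lambda)-|\lambda|$. Set $\tau_{k,d}=\tau_d(\mu^{(0)}_{[k]})$ for $0\le k\le L$, $0\le d\le n+1$. KKR map: it sends such a rigged configuration to $p_1\otimes\cdots\otimes p_L\in B_{\mu^{(0)}_1}\otimes\cdots\otimes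 B_{\mu^{(0)}_L}$ as follows. One performs elementary steps, each removing one box from the row of $\mu^{(0)}$ currently processed and outputting a letter in $\{1,\dots,n+1\}$; the rows $\mu^{(0)}_L,\mu^{(0)}_{L-1},\dots,\mu^{(0)}_1$ are processed in this order, each until empty, and $p_k=(x_1,\dots,x_{n+1})$ with $x_j$ the number of steps during the processing of row $\mu^{(0)}_k$ that output $j$. Elementary step: let $\ell_0$ be the current length of the processed row of $\mu^{(0)}$. For $i=1,2,\dots,n$ in turn, look at the rows of $\mu^{(i)}$ of length $\ge\ell_{i-1}$ that are singular (rigging equal to the current vacancy number $p^{(i)}_\ell$ of its length $\ell$); if some exist choose one of minimal length and call its length $\ell_i$; otherwise stop. Let $j-1$ be the number of rows chosen (so $j\in\{1,\dots,n+1\}$); output $j$. Then remove the last box of the processed row of $\mu^{(0)}$ and of each chosen row in $\mu^{(1)},\dots,\mu^{(j-1)}$ (rows of length $0$ are discarded), recompute all vacancy numbers from the new configuration (including the shortened $\mu^{(0)}$), give each shortened row of $\mu^{(1)},\dots,\mu^{(n)}$ the new vacancy number of its new length as rigging, and keep the riggings of all other rows. (The result does not depend on choices among rows of equal length.) *)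

theory Defs
  imports Main "HOL-Library.Multiset"
begin

text \<open>Rigged configurations of type A_n^(1) and the KKR map.
  The configuration mu^(0) is a list of positive naturals; for 1 <= a <= n the
  rigged partition (mu^(a), r^(a)) is a multiset of pairs (row length, rigging).\<close>

type_synonym rcfg = "nat \<Rightarrow> (nat \<times> int) multiset"

definition minm :: "nat multiset \<Rightarrow> nat multiset \<Rightarrow> int" where
  "minm A B = (\<Sum>x\<in>#A. \<Sum>y\<in>#B. int (min x y))"

definition Eshape :: "nat multiset \<Rightarrow> nat \<Rightarrow> int" where
  "Eshape A j = (\<Sum>x\<in>#A. int (min j x))"

definition shape :: "rcfg \<Rightarrow> nat \<Rightarrow> nat multiset" where
  "shape rc a = image_mset fst (rc a)"

definition Efun :: "nat \<Rightarrow> nat list \<Rightarrow> rcfg \<Rightarrow> nat \<Rightarrow> nat \<Rightarrow> int" where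
  "Efun n m rc a j = (if a = 0 then Eshape (mset m) j
                      else if a \<le> n then Eshape (shape rc a) j else 0)"

definition vac :: "nat \<Rightarrow> nat list \<Rightarrow> rcfg \<Rightarrow> nat \<Rightarrow> nat \<Rightarrow> int" where
  "vac n m rc a j = Efun n m rc (a - 1) j - 2 * Efun n m rc a j + Efun n m rc (a + 1) j"

definition is_rc :: "nat \<Rightarrow> nat list \<Rightarrow> rcfg \<Rightarrow> bool" where
  "is_rc n m rc \<longleftrightarrow> (\<forall>x\<in>set m. 0 < x) \<and>
     (\<forall>a\<in>{1..n}. \<forall>(l, r)\<in>set_mset (rc a). 1 \<le> l \<and> 0 \<le> r \<and> r \<le> vac n m rc a l)"

definition choices :: "nat \<Rightarrow> rcfg \<Rightarrow> rcfg set" where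
  "choices n rc = {S. \<forall>a. (a \<in> {1..n} \<longrightarrow> S a \<subseteq># rc a) \<and> (a \<notin> {1..n} \<longrightarrow> S a = {#})}"

definition tau_val :: "nat \<Rightarrow> nat multiset \<Rightarrow> nat \<Rightarrow> rcfg \<Rightarrow> int" where
  "tau_val n lam d S =
     (let \<nu> = (\<lambda>a. image_mset fst (S a)) in
       minm lam (\<nu> 1) + (\<Sum>a=1..<n. minm (\<nu> a) (\<nu> (a + 1)))
       - (\<Sum>a=1..n. minm (\<nu> a) (\<nu> a))
       - (\<Sum>a=1..n. \<Sum>x\<in>#S a. snd x)
       - (if d \<le> n then int (sum_mset (\<nu> d)) else 0))"

definition tau_pos :: "nat \<Rightarrow> rcfg \<Rightarrow> nat multiset \<Rightarrow> nat \<Rightarrow> int" where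
  "tau_pos n rc lam d = Max (tau_val n lam d ` choices n rc)"

definition tau :: "nat \<Rightarrow> rcfg \<Rightarrow> nat multiset \<Rightarrow> nat \<Rightarrow> int" where
  "tau n rc lam d = (if d = 0 then tau_pos n rc lam (n + 1) - int (sum_mset lam)
                     else tau_pos n rc lam d)"

definition tauk :: "nat \<Rightarrow> nat list \<Rightarrow> rcfg \<Rightarrow> nat \<Rightarrow> nat \<Rightarrow> int" where
  "tauk n m rc k d = tau n rc (mset (take k m)) d"

definition sing_lengths :: "nat \<Rightarrow> nat list \<Rightarrow> rcfg \<Rightarrow> nat \<Rightarrow> nat \<Rightarrow> nat set" where
  "sing_lengths n m rc i l = {l'. l \<le> l' \<and> (l', vac n m rc i l') \<in># rc i}"

primrec selk :: "nat \<Rightarrow> nat \<Rightarrow> nat list \<Rightarrow> rcfg \<Rightarrow> nat \<Rightarrow> nat \<Rightarrow> nat list" where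
  "selk 0 n m rc i l = []"
| "selk (Suc f) n m rc i l =
     (let S = sing_lengths n m rc i l in
       if S = {} then [] else Min S # selk f n m rc (Suc i) (Min S))"

definition kkr_step :: "nat \<Rightarrow> nat list \<times> rcfg \<Rightarrow> nat \<times> (nat list \<times> rcfg)" where
  "kkr_step n st =
    (let m = fst st; rc = snd st;
         ls = selk n n m rc 1 (last m);
         m' = butlast m @ [last m - 1];
         shorten = (\<lambda>R :: rcfg. \<lambda>i. if 1 \<le> i \<and> i \<le> length ls
                        then rc i - {#(ls ! (i - 1), vac n m rc i (ls ! (i - 1)))#} + R i
                        else rc i);
         rc0 = shorten (\<lambda>i. if 1 < ls ! (i - 1) then {#(ls ! (i - 1) - 1, 0)#} else {#});
         rc' = shorten (\<lambda>i. if 1 < ls ! (i - 1)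
                  then {#(ls ! (i - 1) - 1, vac n m' rc0 i (ls ! (i - 1) - 1))#} else {#})
     in (length ls + 1, (m', rc')))"

primrec run_row :: "nat \<Rightarrow> nat \<Rightarrow> nat list \<times> rcfg \<Rightarrow> nat list \<times> (nat list \<times> rcfg)" where
  "run_row n 0 st = ([], st)"
| "run_row n (Suc c) st =
     (let (j, st') = kkr_step n st; (ws, st'') = run_row n c st' in (j # ws, st''))"

text \<open>Rows are processed from the last one to the first; the result lists, for each
  row k (index k-1), the letters output while processing it.\<close>
primrec kkr_rows :: "nat \<Rightarrow> nat \<Rightarrow> nat list \<times> rcfg \<Rightarrow> nat list list" where
  "kkr_rows n 0 st = []"
| "kkr_rows n (Suc k) st =
     (let (ws, st') = run_row n (fst st ! k) st
      in kkr_rows n k (take k (fst st'), snd st') @ [ws])"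

definition kkr :: "nat \<Rightarrow> nat list \<Rightarrow> rcfg \<Rightarrow> nat list list" where
  "kkr n m rc = kkr_rows n (length m) (m, rc)"

definition kkr_x :: "nat \<Rightarrow> nat list \<Rightarrow> rcfg \<Rightarrow> nat \<Rightarrow> nat \<Rightarrow> nat" where
  "kkr_x n m rc k d = count (mset (kkr n m rc ! (k - 1))) d"

end

theory Submission
  imports Defs
begin

text \<open>Write \<open>weight a\<close> for \<open>|\<mu>\<^sup>(\<^sup>a\<^sup>)|\<close>, which is \<open>0\<close> for \<open>a = n + 1\<close>.  Two facts give the theorem.

  For \<open>\<lambda> = \<mu>\<^sup>(\<^sup>0\<^sup>)\<close> the maximum defining \<open>\<tau>\<^sub>d\<close> is attained at the full configuration, because leaving
  out heights \<open>h\<^sub>a\<close> in a column costs at least the Cartan form \<open>\<Sum>h\<^sub>a\<^sup>2 - \<Sum>h\<^sub>ah\<^sub>a\<^sub>+\<^sub>1 \<ge> h\<^sub>d\<close>; hence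
  \<open>\<tau>\<^sub>d(\<mu>\<^sup>(\<^sup>0\<^sup>))\<close> is a constant minus \<open>weight d\<close>.

  Each elementary step preserves \<open>\<tau>\<^sub>d(\<lambda>)\<close> for every \<open>\<lambda>\<close> not using the processed row.  The step is
  carried out one level at a time, the choices on all other levels being fixed.  On one level, trading
  the singular row of length \<open>l\<close> for the shortened row is a concave exchange problem: if the trade
  lowers the value, concavity yields an unused row (the next one not shorter than \<open>l\<close>, or the
  previous one shorter than \<open>l\<close>) that does at least as well.

  A step with output \<open>j\<close> lowers exactly the weights of the levels below \<open>j\<close> by one, so
  \<open>weight (d - 1) - weight d\<close> counts the letters \<open>d\<close>.\<close>

section \<open>Column heights, the pairing \<open>minm\<close> and the value of a single
  level\<close>

lemma Eshape_empty [simp]: "Eshape {#} j = 0"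
  by (simp add: Eshape_def)

lemma Eshape_add_mset [simp]: "Eshape (add_mset x A) j = int (min j x) + Eshape A j"
  by (simp add: Eshape_def)

lemma Eshape_plus [simp]: "Eshape (A + B) j = Eshape A j + Eshape B j"
  by (simp add: Eshape_def)

lemma Eshape_0 [simp]: "Eshape A 0 = 0"
  by (simp add: Eshape_def)

lemma minm_empty [simp]: "minm {#} B = 0" "minm A {#} = 0"
  by (simp_all add: minm_def)

lemma minm_add_mset [simp]:
  "minm (add_mset x A) B = Eshape B x + minm A B"
  "minm A (add_mset x B) = Eshape A x + minm A B"
  by (simp_all add: minm_def Eshape_def sum_mset.distrib min.commute)

lemma minm_plus [simp]:
  "minm (A + B) C = minm A C + minm B C"
  "minm C (A + B) = minm C A + minm C B"
  by (simp_all add: minm_def sum_mset.distrib)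

lemma minm_commute: "minm A B = minm B A"
  by (induction A) auto

lemma minm_conv_sum_Eshape: "minm A B = (\<Sum>x\<in>#A. Eshape B x)"
  by (simp add: minm_def Eshape_def)

text \<open>For \<open>i \<ge> 1\<close> this is the \<open>i\<close>-th part of the conjugate
  partition, the length of column \<open>i\<close> of the Young diagram with row lengths
  \<open>A\<close>.\<close>

definition height :: "nat multiset \<Rightarrow> nat \<Rightarrow> int" where
  "height A i = int (size (filter_mset (\<lambda>x. i \<le> x) A))"

lemma height_simps [simp]:
  "height {#} i = 0"
  "height (add_mset x A) i = of_bool (i \<le> x) + height A i"
  by (simp_all add: height_def)

lemma height_nonneg: "0 \<le> height A i"
  by (simp add: height_def)

lemma height_antimono: "i \<le> j \<Longrightarrow> height A j \<le> height A i"
  by (induction A) auto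

lemma Eshape_Suc: "Eshape A (Suc j) = Eshape A j + height A (Suc j)"
  by (induction A) (auto simp: min_def)

lemma Eshape_conv_sum_height: "Eshape A j = (\<Sum>i<j. height A (Suc i))"
  by (induction j) (simp_all add: Eshape_Suc)

text \<open>\<open>min x y\<close> counts the columns shared by two rows, so the pairing splits into
  one product per column. Columns beyond \<open>J\<close> contain no box of
  \<open>A\<close>.\<close>

lemma minm_conv_sum_height:
  assumes "\<forall>x\<in>#A. x \<le> J"
  shows "minm A B = (\<Sum>i<J. height A (Suc i) * height B (Suc i))"
  using assms
proof (induction A)
  case (add x A)
  have "(\<Sum>i<J. of_bool (Suc i \<le> x) * height B (Suc i)) = (\<Sum>i<x. height B (Suc i))"
    using add.prems by (intro sum.mono_neutral_cong_right) auto
  with add show ?case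
    by (simp add: Eshape_conv_sum_height distrib_right sum.distrib)
qed simp

lemma sum_mset_conv_sum_height:
  assumes "\<forall>x\<in>#A. x \<le> J"
  shows "int (sum_mset A) = (\<Sum>i<J. height A (Suc i))"
  using assms
proof (induction A)
  case (add x A)
  have "(\<Sum>i<J. of_bool (Suc i \<le> x) :: int) = (\<Sum>i<x. 1)"
    using add.prems by (intro sum.mono_neutral_cong_right) auto
  with add show ?case
    by (simp add: sum.distrib)
qed simp

text \<open>Moving the cut-off across a gap in which no row ends earns \<open>c\<close> for each row
  reaching the far end and nothing for the others.\<close>

lemma Eshape_linear_on_gap:
  assumes "\<forall>x\<in>#B. x \<le> t \<or> t + c \<le> x"
  shows "Eshape B (t + c) = Eshape B t + int c * height B (t + c)"
  using assms
proof (induction B)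
  case (add x B)
  then show ?case by (auto simp: min_def algebra_simps)
qed simp

text \<open>The part of \<open>tau_val\<close> that depends on the choice \<open>A\<close> on one
  level: \<open>U t\<close> is what a row of length \<open>t\<close> earns from the neighbouring
  levels, less \<open>t\<close> on level \<open>d\<close> (see
  \<open>tau_val_level\<close>).\<close>

definition level_val :: "(nat \<Rightarrow> int) \<Rightarrow> (nat \<times> int) multiset \<Rightarrow> int" where
  "level_val U A = (\<Sum>x\<in>#A. U (fst x) - snd x) - minm (image_mset fst A) (image_mset fst A)"

lemma level_val_add_mset:
  "level_val U (add_mset (t, r) A) =
     level_val U A + U t - r - 2 * Eshape (image_mset fst A) t - int t"
  by (simp add: level_val_def)

lemma subseteq_add_msetI: "A \<subseteq># R \<Longrightarrow> A \<subseteq># add_mset x R"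
  by (metis add_mset_add_single mset_subset_eq_add_left subset_mset.order_trans)

lemma subseteq_add_mset_cases:
  assumes "A \<subseteq># add_mset x R"
  obtains "A \<subseteq># R" | A0 where "A = add_mset x A0" "A0 \<subseteq># R"
proof (cases "x \<in># A")
  case True
  then obtain A0 where "A = add_mset x A0" by (meson multi_member_split)
  with assms that show ?thesis by simp
next
  case False
  with assms that show ?thesis
    by (metis diff_single_trivial mset_subset_eq_add_mset_cancel subset_eq_diff_conv add_mset_add_single)
qed

section \<open>Exchanging rows on a single level\<close>

locale concave_seq =
  fixes z :: "nat \<Rightarrow> int"
  assumes zero: "z 0 = 0"
    and mono: "z i \<le> z (Suc i)"
    and concave: "z (Suc (Suc i)) - z (Suc i) \<le> z (Suc i) - z i"
begin

lemma slope_antimono: "i \<le> j \<Longrightarrow> z (Suc j) - z j \<le> z (Suc i) - z i"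
proof (induction j rule: dec_induct)
  case (step j)
  then show ?case using concave[of j] by linarith
qed simp

text \<open>The slope just after an interval bounds its mean slope from below; in
  \<open>chord_le\<close> the slope just before it bounds it from above. Hence one increment of
  \<open>z\<close> controls \<open>z\<close> on a whole side.\<close>

lemma chord_ge: "z i + int c * (z (Suc (i + c)) - z (i + c)) \<le> z (i + c)"
proof (induction c)
  case (Suc c)
  define s s' where "s = z (Suc (i + Suc c)) - z (i + Suc c)" and "s' = z (Suc (i + c)) - z (i + c)"
  have "s \<le> s'"
    using slope_antimono[of "i + c" "i + Suc c"] by (auto simp: s_def s'_def)
  then have "int (Suc c) * s \<le> int (Suc c) * s'"
    by (intro mult_left_mono) auto
  moreover have "z (i + Suc c) = z (i + c) + s'"
    by (simp add: s'_def)
  ultimately have "z i + int (Suc c) * s \<le> z (i + Suc c)"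
    using Suc by (simp add: s'_def [symmetric] algebra_simps)
  then show ?case by (simp add: s_def)
qed simp

lemma chord_le: "z (Suc i + c) \<le> z (Suc i) + int c * (z (Suc i) - z i)"
proof (induction c)
  case (Suc c)
  then show ?case
    using slope_antimono[of i "Suc i + c"] by (simp add: algebra_simps)
qed simp

definition gain :: "nat multiset \<Rightarrow> nat \<Rightarrow> nat \<Rightarrow> int" where
  "gain B l t = 2 * Eshape B t + 2 * int (min t l) - int t - z t"

lemma gain_zero [simp]: "gain B l 0 = 0"
  by (simp add: gain_def zero)

lemma gain_step:
  "gain B (Suc k) (Suc k) - gain B (Suc k) k = 2 * height B (Suc k) + 1 - (z (Suc k) - z k)"
  by (simp add: gain_def Eshape_Suc)

lemma gain_lengthen:
  assumes "gain B (Suc k) k < gain B (Suc k) (Suc k) - 1"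
  obtains t where "t \<in># B" "Suc k \<le> t" "gain B (Suc k) (Suc k) \<le> gain B (Suc k) t"
proof -
  define N where "N = height B (Suc k)"
  have slope: "z (Suc k) - z k \<le> 2 * N - 1"
    using assms gain_step[of B k] by (simp add: N_def)
  then have "0 < N"
    using mono[of k] by linarith
  then have "filter_mset (\<lambda>x. Suc k \<le> x) B \<noteq> {#}"
    unfolding nonempty_has_size by (simp add: N_def height_def)
  then obtain x where "x \<in># filter_mset (\<lambda>x. Suc k \<le> x) B"
    by (rule multiset_nonemptyE)
  then have ne: "{x. x \<in># B \<and> Suc k \<le> x} \<noteq> {}"
    by auto
  \<comment> \<open>Up to the shortest such row \<open>Eshape B\<close> has constant slope
    \<open>N\<close>, so \<open>2 * Eshape B t - t\<close> rises by \<open>2 * N - 1\<close> per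
    unit, at least as fast as \<open>z\<close>.\<close>
  define t where "t = Min {x. x \<in># B \<and> Suc k \<le> x}"
  have t: "t \<in># B" "Suc k \<le> t" and t_min: "\<And>x. x \<in># B \<Longrightarrow> Suc k \<le> x \<Longrightarrow> t \<le> x"
    using Min_in[OF _ ne] by (auto simp: t_def)
  obtain c where c: "t = Suc k + c"
    using t(2) le_Suc_ex by blast
  have "height B t = N"
    unfolding N_def height_def
    using t(2) t_min by (intro arg_cong[where f = "\<lambda>M. int (size M)"] filter_mset_cong) auto
  moreover have "\<forall>x\<in>#B. x \<le> Suc k \<or> Suc k + c \<le> x"
    using t_min c by (metis nle_le)
  ultimately have "Eshape B t = Eshape B (Suc k) + int c * N"
    using Eshape_linear_on_gap[of B "Suc k" c] c by simp
  moreover have "int c * (z (Suc k) - z k) \<le> int c * (2 * N - 1)"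
    using slope by (intro mult_left_mono) auto
  then have "z t \<le> z (Suc k) + int c * (2 * N - 1)"
    using chord_le[of k c] c by simp
  ultimately have "gain B (Suc k) (Suc k) \<le> gain B (Suc k) t"
    by (simp add: gain_def c algebra_simps)
  with t that show ?thesis by blast
qed

lemma gain_shorten:
  assumes "gain B (Suc k) (Suc k) - 1 < gain B (Suc k) k"
  obtains t where "t = 0 \<or> t \<in># B" "t \<le> k" "gain B (Suc k) k \<le> gain B (Suc k) t"
proof -
  define N where "N = height B (Suc k)"
  have slope: "2 * N + 1 \<le> z (Suc k) - z k"
    using assms gain_step[of B k] by (simp add: N_def)
  \<comment> \<open>The default \<open>0\<close> stands for adding no row at all, with gain
    \<open>0\<close>. Between \<open>t\<close> and \<open>k\<close> the gain has slope
    \<open>2 * N + 1\<close> minus that of \<open>z\<close>, hence is nonincreasing there.\<close>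
  define t where "t = Max (insert 0 {x. x \<in># B \<and> x \<le> k})"
  have fin: "finite {x. x \<in># B \<and> x \<le> k}"
    by auto
  have "t \<in> insert 0 {x. x \<in># B \<and> x \<le> k}"
    unfolding t_def using fin by (intro Max_in) auto
  then have t: "t = 0 \<or> t \<in># B" "t \<le> k" by auto
  have t_max: "x \<le> t" if "x \<in># B" "x \<le> k" for x
    unfolding t_def using fin that by (intro Max_ge) auto
  obtain c where c: "k = t + c"
    using t(2) le_Suc_ex by blast
  have "height B (t + Suc c) = N"
    by (simp add: N_def c)
  moreover have "\<forall>x\<in>#B. x \<le> t \<or> t + Suc c \<le> x"
    using t_max c by force
  ultimately have "Eshape B (Suc k) = Eshape B t + int (Suc c) * N"
    using Eshape_linear_on_gap[of B t "Suc c"] c by simp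
  then have "Eshape B k = Eshape B t + int c * N"
    using Eshape_Suc[of B k] by (simp add: N_def algebra_simps)
  moreover have "int c * (2 * N + 1) \<le> int c * (z (Suc k) - z k)"
    using slope by (intro mult_left_mono) auto
  then have "z t + int c * (2 * N + 1) \<le> z k"
    using chord_ge[of t c] c by simp
  ultimately have "gain B (Suc k) k \<le> gain B (Suc k) t"
    by (simp add: gain_def c algebra_simps)
  with t that show ?thesis by blast
qed

text \<open>One level of the configuration with everything else held fixed: the singular row of length
  \<open>Suc k\<close> is cut to length \<open>k\<close>, with rigging the new vacancy number.  Here \<open>P\<close> is the vacancy number
  after the levels below have been shortened, and \<open>z\<close> measures what the neighbouring levels leave out.\<close>
context
  fixes R0 :: "(nat \<times> int) multiset" and U P :: "nat \<Rightarrow> int" and k :: nat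
  assumes U_eq: "\<And>t. U t = P t + 2 * Eshape (image_mset fst R0) t + 2 * int (min t (Suc k)) - z t"
    and short_rows: "\<And>t r. (t, r) \<in># R0 \<Longrightarrow> t \<le> k \<Longrightarrow> r \<le> P t"
    and long_rows: "\<And>t r. (t, r) \<in># R0 \<Longrightarrow> Suc k \<le> t \<Longrightarrow> r \<le> P t + 1"
begin

lemma level_val_add_row:
  assumes "A0 \<subseteq># R0"
  shows "level_val U (add_mset (t, r) A0) =
    level_val U A0 + (P t - r) + gain (image_mset fst (R0 - A0)) (Suc k) t"
proof -
  have "R0 = A0 + (R0 - A0)" using assms by simp
  then have "Eshape (image_mset fst R0) t =
      Eshape (image_mset fst A0) t + Eshape (image_mset fst (R0 - A0)) t"
    by (metis Eshape_plus image_mset_union)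
  then show ?thesis
    by (simp add: level_val_add_mset U_eq gain_def)
qed

lemma add_row_subset:
  assumes "A0 \<subseteq># R0" "t \<in># image_mset fst (R0 - A0)"
  obtains r where "(t, r) \<in># R0" "add_mset (t, r) A0 \<subseteq># R0"
proof -
  obtain r where r: "(t, r) \<in># R0 - A0" using assms(2) by auto
  then have "(t, r) \<in># R0" by (meson in_diffD)
  moreover have "add_mset (t, r) A0 \<subseteq># R0"
    using r assms(1) by (metis insert_subset_eq_iff add_mset_add_single subset_mset.le_diff_conv2
        mset_subset_eq_single union_commute)
  ultimately show ?thesis using that by blast
qed

lemma level_exchange_cut:
  assumes "A \<subseteq># add_mset (Suc k, P (Suc k) + 1) R0"
  shows "\<exists>A'. A' \<subseteq># R0 + (if 0 < k then {#(k, P k)#} else {#}) \<and> level_val U A \<le> level_val U A'"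
  using assms
proof (cases rule: subseteq_add_mset_cases)
  case 1
  then show ?thesis by (intro exI[of _ A]) (auto intro: subseteq_add_msetI)
next
  case (2 A0)
  define B where "B = image_mset fst (R0 - A0)"
  have A: "level_val U A = level_val U A0 - 1 + gain B (Suc k) (Suc k)"
    by (simp add: 2 level_val_add_row B_def)
  show ?thesis
  proof (cases "gain B (Suc k) (Suc k) - 1 \<le> gain B (Suc k) k")
    case True
    show ?thesis
    proof (cases "k = 0")
      case True
      with \<open>gain B (Suc k) (Suc k) - 1 \<le> gain B (Suc k) k\<close> show ?thesis
        using 2(2) A by (intro exI[of _ A0]) simp
    next
      case False
      then show ?thesis
        using 2(2) A \<open>gain B (Suc k) (Suc k) - 1 \<le> gain B (Suc k) k\<close>
        by (intro exI[of _ "add_mset (k, P k) A0"]) (simp add: level_val_add_row B_def)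
    qed
  next
    case False
    then obtain t where t: "t \<in># B" "Suc k \<le> t" "gain B (Suc k) (Suc k) \<le> gain B (Suc k) t"
      using gain_lengthen[of B k] by auto
    then obtain r where r: "(t, r) \<in># R0" "add_mset (t, r) A0 \<subseteq># R0"
      using add_row_subset[OF 2(2)] by (auto simp: B_def)
    show ?thesis
      using r t 2(2) A long_rows[OF r(1) t(2)]
      by (intro exI[of _ "add_mset (t, r) A0"])
        (auto simp: level_val_add_row B_def intro: subseteq_add_msetI)
  qed
qed

lemma level_exchange_uncut:
  assumes "A \<subseteq># R0 + (if 0 < k then {#(k, P k)#} else {#})"
  shows "\<exists>A'. A' \<subseteq># add_mset (Suc k, P (Suc k) + 1) R0 \<and> level_val U A \<le> level_val U A'"
proof (cases "A \<subseteq># R0")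
  case True
  then show ?thesis
    by (intro exI[of _ A]) (auto intro: subseteq_add_msetI)
next
  case False
  then have "0 < k" using assms by (auto split: if_splits)
  with assms have "A \<subseteq># add_mset (k, P k) R0" by simp
  with False obtain A0 where A0: "A = add_mset (k, P k) A0" "A0 \<subseteq># R0"
    by (auto elim: subseteq_add_mset_cases)
  define B where "B = image_mset fst (R0 - A0)"
  have A: "level_val U A = level_val U A0 + gain B (Suc k) k"
    by (simp add: A0 level_val_add_row B_def)
  show ?thesis
  proof (cases "gain B (Suc k) k \<le> gain B (Suc k) (Suc k) - 1")
    case True
    then show ?thesis
      using A0(2) A
      by (intro exI[of _ "add_mset (Suc k, P (Suc k) + 1) A0"]) (simp add: level_val_add_row B_def)
  next
    case False
    then obtain t where t: "t = 0 \<or> t \<in># B" "t \<le> k" "gain B (Suc k) k \<le> gain B (Suc k) t"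
      using gain_shorten[of B k] by auto
    from t(1) show ?thesis
    proof
      assume "t = 0"
      with t(3) A A0(2) show ?thesis
        by (intro exI[of _ A0]) (auto intro: subseteq_add_msetI)
    next
      assume "t \<in># B"
      then obtain r where r: "(t, r) \<in># R0" "add_mset (t, r) A0 \<subseteq># R0"
        using add_row_subset[OF A0(2)] by (auto simp: B_def)
      show ?thesis
        using r t A0(2) A short_rows[OF r(1) t(2)]
        by (intro exI[of _ "add_mset (t, r) A0"])
          (auto simp: level_val_add_row B_def intro: subseteq_add_msetI)
    qed
  qed
qed

end

end

section \<open>Removing one box leaves the remaining tau functions unchanged\<close>

lemma tau_val_level:
  assumes a: "a \<in> {1..n}"
    and U: "\<And>t. U t = Eshape (if a = 1 then lam else shape S (a - 1)) t
      + (if a < n then Eshape (shape S (a + 1)) t else 0) - (if a = d then int t else 0)"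
  shows "tau_val n lam d (S(a := A)) = tau_val n lam d (S(a := {#})) + level_val U A"
proof -
  define B where "B = image_mset fst A"
  define s where "s = shape S"
  define Y where "Y = s(a := {#})"
  define X where "X = s(a := B)"
  have X: "image_mset fst ((S(a := A)) c) = X c" for c
    by (simp add: X_def s_def shape_def B_def)
  have Y: "image_mset fst ((S(a := {#})) c) = Y c" for c
    by (simp add: Y_def s_def shape_def)
  \<comment> \<open>Level \<open>a\<close> meets its upper neighbour in the term
    \<open>c = a\<close> and its lower one in \<open>c = a - 1\<close>. For \<open>a = 1\<close> the
    latter is outside the range, and \<open>lam\<close> takes its place in
    \<open>bottom\<close>.\<close>
  have "(\<Sum>c=1..<n. minm (X c) (X (c + 1))) = (\<Sum>c=1..<n. minm (Y c) (Y (c + 1))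
      + (if c = a then minm B (s (a + 1)) else 0) + (if c = a - 1 then minm (s (a - 1)) B else 0))"
    using a by (intro sum.cong) (auto simp: X_def Y_def)
  then have coupling: "(\<Sum>c=1..<n. minm (X c) (X (c + 1))) = (\<Sum>c=1..<n. minm (Y c) (Y (c + 1)))
      + (if a < n then minm B (s (a + 1)) else 0) + (if 1 < a then minm (s (a - 1)) B else 0)"
    using a by (auto simp: sum.distrib)
  have "(\<Sum>c=1..n. minm (X c) (X c)) =
      (\<Sum>c=1..n. minm (Y c) (Y c) + (if c = a then minm B B else 0))"
    by (intro sum.cong) (auto simp: X_def Y_def)
  then have self: "(\<Sum>c=1..n. minm (X c) (X c)) = (\<Sum>c=1..n. minm (Y c) (Y c)) + minm B B"
    using a by (simp add: sum.distrib)
  have "(\<Sum>c=1..n. \<Sum>x\<in>#(S(a := A)) c. snd x) =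
      (\<Sum>c=1..n. (\<Sum>x\<in>#(S(a := {#})) c. snd x) + (if c = a then (\<Sum>x\<in>#A. snd x) else 0))"
    by (intro sum.cong) auto
  then have riggings: "(\<Sum>c=1..n. \<Sum>x\<in>#(S(a := A)) c. snd x) =
      (\<Sum>c=1..n. \<Sum>x\<in>#(S(a := {#})) c. snd x) + (\<Sum>x\<in>#A. snd x)"
    using a by (simp add: sum.distrib)
  have bottom: "minm lam (X 1) = minm lam (Y 1) + (if a = 1 then minm lam B else 0)"
    by (simp add: X_def Y_def)
  have mass: "(if d \<le> n then int (sum_mset (X d)) else 0) =
      (if d \<le> n then int (sum_mset (Y d)) else 0) + (if a = d then int (sum_mset B) else 0)"
    using a by (auto simp: X_def Y_def)
  have "(\<Sum>x\<in>#A. U (fst x) - snd x) = (if a = 1 then minm lam B else minm (s (a - 1)) B)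
      + (if a < n then minm B (s (a + 1)) else 0) - (if a = d then int (sum_mset B) else 0)
      - (\<Sum>x\<in>#A. snd x)"
    unfolding B_def by (induction A) (auto simp: U s_def)
  then have "level_val U A = (if a = 1 then minm lam B else minm (s (a - 1)) B)
      + (if a < n then minm B (s (a + 1)) else 0) - (if a = d then int (sum_mset B) else 0)
      - (\<Sum>x\<in>#A. snd x) - minm B B"
    by (simp add: level_val_def B_def)
  then show ?thesis
    unfolding tau_val_def Let_def X Y using coupling self riggings bottom mass a
    by (auto split: if_splits)
qed

lemma finite_submsets: "finite {M. M \<subseteq># X}"
proof (induction X)
  case (add x X)
  have "{M. M \<subseteq># add_mset x X} \<subseteq> {M. M \<subseteq># X} \<union> add_mset x ` {M. M \<subseteq># X}"
    by (auto elim: subseteq_add_mset_cases)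
  with add show ?case
    by (meson finite_UnI finite_imageI finite_subset)
qed simp

lemma finite_choices: "finite (choices n rc)"
proof -
  have "choices n rc \<subseteq> {S. \<forall>a. (a \<in> {1..n} \<longrightarrow> S a \<in> (\<Union>c\<in>{1..n}. {M. M \<subseteq># rc c}))
      \<and> (a \<notin> {1..n} \<longrightarrow> S a = {#})}"
    by (auto simp: choices_def)
  then show ?thesis
    by (rule finite_subset) (intro finite_set_of_finite_funs, auto simp: finite_submsets)
qed

lemma choices_cong: "(\<And>a. a \<in> {1..n} \<Longrightarrow> R a = R' a) \<Longrightarrow> choices n R = choices n R'"
  by (auto simp: choices_def)

lemma choices_update:
  assumes "S \<in> choices n R" "a \<in> {1..n}" "A \<subseteq># R' a" "\<And>c. c \<in> {1..n} \<Longrightarrow> c \<noteq> a \<Longrightarrow> R' c = R c"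
  shows "S(a := A) \<in> choices n R'"
  using assms by (auto simp: choices_def)

lemma tau_pos_leI:
  assumes "\<And>S. S \<in> choices n rc \<Longrightarrow> \<exists>S'\<in>choices n rc'. tau_val n lam d S \<le> tau_val n lam d S'"
  shows "tau_pos n rc lam d \<le> tau_pos n rc' lam d"
proof -
  have "(\<lambda>_. {#}) \<in> choices n rc" by (simp add: choices_def)
  then have "tau_val n lam d ` choices n rc \<noteq> {}" by blast
  moreover have "tau_val n lam d S \<le> tau_pos n rc' lam d" if S: "S \<in> choices n rc" for S
  proof -
    obtain S' where "S' \<in> choices n rc'" "tau_val n lam d S \<le> tau_val n lam d S'"
      using assms[OF S] by blast
    then show ?thesis
      unfolding tau_pos_def by (intro order.trans[OF _ Max_ge]) (auto simp: finite_choices)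
  qed
  ultimately show ?thesis
    unfolding tau_pos_def[of n rc] by (intro Max.boundedI) (auto simp: finite_choices)
qed

section \<open>The rows selected by an elementary step and the change of vacancy numbers\<close>

definition valid :: "nat \<Rightarrow> nat list \<Rightarrow> rcfg \<Rightarrow> bool" where
  "valid n m rc \<longleftrightarrow> (\<forall>a\<in>{1..n}. \<forall>(l, r)\<in>#rc a. 1 \<le> l \<and> r \<le> vac n m rc a l)"

lemma finite_sing_lengths: "finite (sing_lengths n m rc i l)"
proof -
  have "sing_lengths n m rc i l \<subseteq> fst ` set_mset (rc i)"
    by (force simp: sing_lengths_def)
  then show ?thesis by (rule finite_subset) simp
qed

lemma length_selk: "length (selk f n m rc i l) \<le> f"
  by (induction f arbitrary: i l) (auto simp: Let_def)

text \<open>Prepending \<open>l\<close> shifts the index by one, so that entry \<open>c\<close> of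
  the longer list is the lower bound used in selecting entry \<open>c\<close> of the shorter
  one.\<close>

lemma selk_minimal:
  assumes "c < length (selk f n m rc i l)"
  shows "selk f n m rc i l ! c \<in> sing_lengths n m rc (i + c) ((l # selk f n m rc i l) ! c) \<and>
    (\<forall>x\<in>sing_lengths n m rc (i + c) ((l # selk f n m rc i l) ! c). selk f n m rc i l ! c \<le> x)"
  using assms
proof (induction f arbitrary: i l c)
  case (Suc f)
  note IH = Suc.IH and prems = Suc.prems
  let ?S = "sing_lengths n m rc i l"
  define x0 ys where "x0 = Min ?S" and "ys = selk f n m rc (Suc i) x0"
  have ne: "?S \<noteq> {}"
    using Suc.prems by (cases "?S = {}") (simp_all add: Let_def)
  then have sel: "selk (Suc f) n m rc i l = x0 # ys"
    by (simp add: Let_def x0_def ys_def)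
  show ?case
  proof (cases c)
    case 0
    then show ?thesis
      unfolding sel by (simp add: x0_def finite_sing_lengths ne)
  next
    case (Suc c')
    then show ?thesis
      using prems IH[of c' "Suc i" x0] unfolding sel ys_def [symmetric] by simp
  qed
qed simp

text \<open>A list shorter than the fuel \<open>f\<close> ended for want of a singular row, not for
  want of fuel.\<close>

lemma selk_stop:
  assumes "length (selk f n m rc i l) < f"
  shows "sing_lengths n m rc (i + length (selk f n m rc i l))
    ((l # selk f n m rc i l) ! length (selk f n m rc i l)) = {}"
  using assms
proof (induction f arbitrary: i l)
  case (Suc f)
  let ?S = "sing_lengths n m rc i l"
  from Suc.prems Suc.IH[of "Suc i" "Min ?S"] show ?case
    by (auto simp: Let_def split: if_splits)
qed simp

text \<open>The increments of \<open>Eshape\<close> are column heights, which are nonnegative and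
  weakly decreasing.\<close>

lemma concave_seqI:
  "concave_seq (\<lambda>t. Eshape A t + Eshape B t + (if b then int t else 0))"
proof
  fix i
  show "Eshape A i + Eshape B i + (if b then int i else 0) \<le>
      Eshape A (Suc i) + Eshape B (Suc i) + (if b then int (Suc i) else 0)"
    using height_nonneg[of A "Suc i"] height_nonneg[of B "Suc i"] by (simp add: Eshape_Suc)
  show "Eshape A (Suc (Suc i)) + Eshape B (Suc (Suc i)) + (if b then int (Suc (Suc i)) else 0)
      - (Eshape A (Suc i) + Eshape B (Suc i) + (if b then int (Suc i) else 0)) \<le>
      Eshape A (Suc i) + Eshape B (Suc i) + (if b then int (Suc i) else 0)
      - (Eshape A i + Eshape B i + (if b then int i else 0))"
    using height_antimono[of "Suc i" "Suc (Suc i)" A] height_antimono[of "Suc i" "Suc (Suc i)" B]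
    by (simp add: Eshape_Suc)
qed simp

lemma Eshape_diff: "A \<subseteq># B \<Longrightarrow> Eshape (B - A) j = Eshape B j - Eshape A j"
  by (metis Eshape_plus add_diff_cancel_left' subset_mset.add_diff_inverse)

lemma shape_mono: "S a \<subseteq># R a \<Longrightarrow> shape S a \<subseteq># shape R a"
  by (simp add: shape_def image_mset_subseteq_mono)

lemma vac_cong:
  assumes "\<And>a. shape R a = shape R' a"
  shows "vac n m R = vac n m R'"
  using assms by (simp add: fun_eq_iff vac_def Efun_def)

locale box_removal =
  fixes n :: nat and m :: "nat list" and rc :: rcfg
  assumes valid: "valid n m rc" and nonempty: "m \<noteq> []" and last_pos: "1 \<le> last m"
begin

definition "ls = selk n n m rc 1 (last m)"
definition "ell a = (last m # ls) ! a"
definition "m' = butlast m @ [last m - 1]"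
definition "rc' = snd (snd (kkr_step n (m, rc)))"
definition "rest a = rc a - {#(ell a, vac n m rc a (ell a))#}"

text \<open>The amount by which the step lowers \<open>Efun\<close> at \<open>t\<close> on level
  \<open>a\<close>, the processed row counting as level \<open>0\<close> (see
  \<open>Efun_step\<close>).\<close>

definition cut :: "nat \<Rightarrow> nat \<Rightarrow> int" where
  "cut a t = of_bool (a \<le> length ls \<and> ell a \<le> t)"

lemma ell_0: "ell 0 = last m" by (simp add: ell_def)

lemma length_ls: "length ls \<le> n" by (simp add: ls_def length_selk)

lemma ell_sing:
  assumes "1 \<le> a" "a \<le> length ls"
  shows "ell a \<in> sing_lengths n m rc a (ell (a - 1))"
    and "x \<in> sing_lengths n m rc a (ell (a - 1)) \<Longrightarrow> ell a \<le> x"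
proof -
  have "a - 1 < length ls" "ell a = ls ! (a - 1)"
    using assms by (auto simp: ell_def nth_Cons')
  then show "ell a \<in> sing_lengths n m rc a (ell (a - 1))"
    and "x \<in> sing_lengths n m rc a (ell (a - 1)) \<Longrightarrow> ell a \<le> x"
    using selk_minimal[of "a - 1" n n m rc 1 "last m"] assms(1) by (auto simp: ls_def ell_def)
qed

lemma ell_stop: "length ls < n \<Longrightarrow> sing_lengths n m rc (Suc (length ls)) (ell (length ls)) = {}"
  using selk_stop[of n n m rc 1 "last m"] by (simp add: ls_def ell_def)

lemma ell_mono: "a < length ls \<Longrightarrow> ell a \<le> ell (Suc a)"
  using ell_sing(1)[of "Suc a"] by (auto simp: sing_lengths_def)

lemma ell_pos: "a \<le> length ls \<Longrightarrow> 1 \<le> ell a"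
proof (induction a)
  case (Suc a)
  then show ?case using ell_mono[of a] by linarith
qed (use last_pos in \<open>simp add: ell_0\<close>)

lemma cut_antimono: "cut (Suc a) t \<le> cut a t"
  using ell_mono[of a] by (auto simp: cut_def)

text \<open>\<open>cut (a - 1) t = 1\<close> makes length \<open>t\<close> eligible on level
  \<open>a\<close>, while \<open>cut a t = 0\<close> says that the selection there took a longer row
  or none. A singular row of length \<open>t\<close> would contradict minimality or the
  stop.\<close>

lemma nonsingular:
  assumes "1 \<le> a" "a \<le> n" "(t, r) \<in># rc a" "cut (a - 1) t = 1" "cut a t = 0"
  shows "r < vac n m rc a t"
proof -
  have le: "r \<le> vac n m rc a t"
    using assms valid by (force simp: valid_def)
  have prev: "a - 1 \<le> length ls" "ell (a - 1) \<le> t"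
    using assms(4) by (auto simp: cut_def)
  have "t \<notin> sing_lengths n m rc a (ell (a - 1))"
  proof (cases "a \<le> length ls")
    case True
    then show ?thesis using ell_sing(2)[of a t] assms by (auto simp: cut_def)
  next
    case False
    then have "a = Suc (length ls)" using prev assms(1) by simp
    then show ?thesis using ell_stop assms(2) by simp
  qed
  with le prev assms(3) show ?thesis
    by (auto simp: sing_lengths_def order.order_iff_strict)
qed

lemma rc_split:
  assumes "1 \<le> a" "a \<le> length ls"
  shows "rc a = add_mset (ell a, vac n m rc a (ell a)) (rest a)"
  using ell_sing(1)[OF assms] by (simp add: rest_def sing_lengths_def)

lemma step_eq: "kkr_step n (m, rc) = (length ls + 1, (m', rc'))"
  by (simp add: rc'_def kkr_step_def Let_def m'_def ls_def)

text \<open>The step reads the new riggings off an auxiliary configuration with placeholder riggings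
  \<open>0\<close>. It has the shapes of \<open>rc'\<close>, and vacancy numbers depend on shapes
  only.\<close>

lemma rc'_cut:
  assumes "1 \<le> a" "a \<le> length ls"
  shows "rc' a = rest a + (if 0 < ell a - 1 then {#(ell a - 1, vac n m' rc' a (ell a - 1))#} else {#})"
proof -
  define rc0 :: rcfg where "rc0 = (\<lambda>i. if 1 \<le> i \<and> i \<le> length ls
    then rc i - {#(ls ! (i - 1), vac n m rc i (ls ! (i - 1)))#} +
      (if 1 < ls ! (i - 1) then {#(ls ! (i - 1) - 1, 0)#} else {#}) else rc i)"
  have rc': "rc' i = (if 1 \<le> i \<and> i \<le> length ls
    then rc i - {#(ls ! (i - 1), vac n m rc i (ls ! (i - 1)))#} +
      (if 1 < ls ! (i - 1) then {#(ls ! (i - 1) - 1, vac n m' rc0 i (ls ! (i - 1) - 1))#} else {#})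
    else rc i)" for i
    by (simp only: rc'_def kkr_step_def Let_def fst_conv snd_conv ls_def [symmetric]
        m'_def [symmetric] rc0_def)
  have "shape rc0 i = shape rc' i" for i
    by (simp add: shape_def rc' rc0_def)
  then have "vac n m' rc0 = vac n m' rc'" by (rule vac_cong)
  then show ?thesis
    using assms by (simp add: rc' rest_def ell_def nth_Cons' less_diff_conv)
qed

lemma rc'_uncut:
  assumes "a = 0 \<or> length ls < a"
  shows "rc' a = rc a"
  using assms by (auto simp: rc'_def kkr_step_def Let_def ls_def)

lemma Eshape_cut:
  assumes "1 \<le> x"
  shows "Eshape ((if 0 < x - 1 then {#x - 1#} else {#}) + A) t =
    Eshape (add_mset x A) t - of_bool (x \<le> t)"
  using assms by (auto simp: min_def)

lemma Efun_step: "Efun n m' rc' a t = Efun n m rc a t - cut a t"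
proof -
  consider "a = 0" | "1 \<le> a" "a \<le> length ls" | "length ls < a" by linarith
  then show ?thesis
  proof cases
    case 1
    have "mset m = add_mset (last m) (mset (butlast m))"
      using nonempty by (metis append_butlast_last_id mset_append mset.simps add_mset_add_single)
    then show ?thesis
      using last_pos by (auto simp: 1 Efun_def m'_def cut_def ell_0 min_def)
  next
    case 2
    have "shape rc' a = (if 0 < ell a - 1 then {#ell a - 1#} else {#}) + shape rest a"
      by (simp add: shape_def rc'_cut[OF 2])
    moreover have "shape rc a = add_mset (ell a) (shape rest a)"
      by (simp add: shape_def rc_split[OF 2])
    ultimately show ?thesis
      using 2 length_ls Eshape_cut[OF ell_pos[OF 2(2)], of "shape rest a" t]
      by (simp add: Efun_def cut_def)
  next
    case 3
    then show ?thesis by (simp add: Efun_def cut_def rc'_uncut shape_def)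
  qed
qed

lemma vac_step:
  "vac n m' rc' a t = vac n m rc a t - cut (a - 1) t + 2 * cut a t - cut (a + 1) t"
  by (simp add: vac_def Efun_step)

lemma cut_01: "cut a t = 0 \<or> cut a t = 1"
  by (simp add: cut_def)

text \<open>Since \<open>cut\<close> is \<open>0\<close> or \<open>1\<close> and decreases with the
  level, a vacancy number drops, by one, only where \<open>cut (a - 1) = 1\<close> and
  \<open>cut a = 0\<close>; there \<open>nonsingular\<close> leaves room. Shortened rows meet the
  bound with equality.\<close>

lemma valid_step: "valid n m' rc'"
proof -
  have old: "1 \<le> x \<and> r \<le> vac n m' rc' a x" if a: "a \<in> {1..n}" and r: "(x, r) \<in># rc a" for a x r
  proof -
    have "1 \<le> x" "r \<le> vac n m rc a x"
      using a r valid by (force simp: valid_def)+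
    moreover have "r < vac n m rc a x" if "cut (a - 1) x = 1" "cut a x = 0"
      using nonsingular[of a x r] a r that by simp
    moreover have "cut (a + 1) x \<le> cut a x" "cut a x \<le> cut (a - 1) x"
      using cut_antimono[of a x] cut_antimono[of "a - 1" x] a by auto
    ultimately show ?thesis
      using cut_01[of a x] cut_01[of "a - 1" x] cut_01[of "a + 1" x] by (auto simp: vac_step)
  qed
  have "1 \<le> x \<and> r \<le> vac n m' rc' a x" if a: "a \<in> {1..n}" and r: "(x, r) \<in># rc' a" for a x r
  proof (cases "a \<le> length ls")
    case True
    with a have a': "1 \<le> a" "a \<le> length ls" by auto
    from r consider "(x, r) \<in># rest a" | "0 < ell a - 1" "(x, r) = (ell a - 1, vac n m' rc' a (ell a - 1))"
      by (auto simp: rc'_cut[OF a'] split: if_splits)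
    then show ?thesis
      by cases (use old[OF a] in \<open>auto simp: rest_def dest: in_diffD\<close>)
  next
    case False
    with old[OF a] r show ?thesis by (simp add: rc'_uncut)
  qed
  then show ?thesis unfolding valid_def by blast
qed

section \<open>Passing from \<open>rc\<close> to \<open>rc'\<close> one level at a time,
  upwards\<close>

definition hybrid :: "nat \<Rightarrow> rcfg" where
  "hybrid b i = (if i < b then rc' i else rc i)"

lemma level_invariance:
  assumes a: "1 \<le> a" "a \<le> length ls" and lam: "lam \<subseteq># mset (butlast m)"
    and below: "1 < a \<Longrightarrow> S (a - 1) \<subseteq># rc' (a - 1)"
    and above: "a < n \<Longrightarrow> S (a + 1) \<subseteq># rc (a + 1)"
  shows "A \<subseteq># rc a \<Longrightarrow> \<exists>A'. A' \<subseteq># rc' a \<and> tau_val n lam d (S(a := A)) \<le> tau_val n lam d (S(a := A'))"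
    and "A \<subseteq># rc' a \<Longrightarrow> \<exists>A'. A' \<subseteq># rc a \<and> tau_val n lam d (S(a := A)) \<le> tau_val n lam d (S(a := A'))"
proof -
  define k where "k = ell a - 1"
  have k: "ell a = Suc k"
    using ell_pos[OF a(2)] by (simp add: k_def)
  \<comment> \<open>\<open>C\<close> and \<open>D\<close> are what the neighbours leave out, the
    lower neighbour being already shortened and the upper one not yet. On the bottom level
    \<open>lam\<close> avoids the processed row, so it still lies in \<open>m'\<close>.\<close>
  define C where "C = (if a = 1 then mset m' - lam else shape rc' (a - 1) - shape S (a - 1))"
  define D where "D = (if a < n then shape rc (a + 1) - shape S (a + 1) else {#})"
  define z where "z = (\<lambda>t. Eshape C t + Eshape D t + (if a = d then int t else 0))"
  define P where "P t = vac n m rc a t - cut (a - 1) t" for t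
  define U where "U t = Eshape (if a = 1 then lam else shape S (a - 1)) t
    + (if a < n then Eshape (shape S (a + 1)) t else 0) - (if a = d then int t else 0)" for t
  interpret concave_seq z
    unfolding z_def by (rule concave_seqI)
  have "lam \<subseteq># mset m'"
    using lam by (simp add: m'_def subseteq_add_msetI)
  then have C: "Eshape C t = Efun n m' rc' (a - 1) t - Eshape (if a = 1 then lam else shape S (a - 1)) t"
    for t
    using a length_ls below shape_mono[of S "a - 1" rc'] by (auto simp: C_def Efun_def Eshape_diff)
  have D: "Eshape D t = Efun n m rc (a + 1) t - (if a < n then Eshape (shape S (a + 1)) t else 0)" for t
    using a above shape_mono[of S "a + 1" rc] by (auto simp: D_def Efun_def Eshape_diff)
  have self: "Efun n m rc a t = Eshape (image_mset fst (rest a)) t + int (min t (Suc k))" for t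
    using a length_ls rc_split[OF a] by (simp add: Efun_def shape_def k)
  have U_eq: "U t = P t + 2 * Eshape (image_mset fst (rest a)) t + 2 * int (min t (Suc k)) - z t" for t
    using C[of t] D[of t] self[of t] Efun_step[of "a - 1" t]
    by (simp add: U_def P_def z_def vac_def)
  have row: "r \<le> vac n m rc a t" "t < Suc k \<Longrightarrow> cut (a - 1) t = 1 \<Longrightarrow> r < vac n m rc a t"
    if "(t, r) \<in># rest a" for t r
  proof -
    have "(t, r) \<in># rc a" using that by (auto simp: rest_def dest: in_diffD)
    with a length_ls valid nonsingular[of a t r] show "r \<le> vac n m rc a t"
      "t < Suc k \<Longrightarrow> cut (a - 1) t = 1 \<Longrightarrow> r < vac n m rc a t"
      by (force simp: valid_def cut_def k)+
  qed
  \<comment> \<open>\<open>P\<close> is below the old vacancy number only where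
    \<open>cut (a - 1) = 1\<close>. Rows shorter than the selected one are nonsingular there; longer
    ones may be singular and exceed \<open>P\<close> by one.\<close>
  have short: "r \<le> P t" if "(t, r) \<in># rest a" "t \<le> k" for t r
    using row[OF that(1)] that(2) cut_01[of "a - 1" t] by (auto simp: P_def)
  have long: "r \<le> P t + 1" if "(t, r) \<in># rest a" "Suc k \<le> t" for t r
    using row[OF that(1)] cut_01[of "a - 1" t] by (auto simp: P_def)
  have "cut (a - 1) (ell a) = 1"
    using a ell_mono[of "a - 1"] by (simp add: cut_def)
  then have uncut: "rc a = add_mset (Suc k, P (Suc k) + 1) (rest a)"
    using rc_split[OF a] by (simp add: P_def k)
  \<comment> \<open>Since \<open>k < ell a\<close>, the cuts on levels \<open>a\<close> and
    \<open>a + 1\<close> do not reach \<open>k\<close>, so the final vacancy number at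
    \<open>k\<close> is already \<open>P k\<close>.\<close>
  have "cut a k = 0" "cut (a + 1) k = 0"
    using cut_antimono[of a k] cut_01[of "a + 1" k] by (auto simp: cut_def k)
  then have cut: "rc' a = rest a + (if 0 < k then {#(k, P k)#} else {#})"
    using rc'_cut[OF a] by (simp add: k P_def vac_step)
  have val: "tau_val n lam d (S(a := X)) = tau_val n lam d (S(a := {#})) + level_val U X" for X
    using a length_ls by (intro tau_val_level) (auto simp: U_def)
  have val_le: "tau_val n lam d (S(a := X)) \<le> tau_val n lam d (S(a := Y)) \<longleftrightarrow>
      level_val U X \<le> level_val U Y" for X Y
    using val[of X] val[of Y] by linarith
  show "\<exists>A'. A' \<subseteq># rc' a \<and> tau_val n lam d (S(a := A)) \<le> tau_val n lam d (S(a := A'))"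
    if "A \<subseteq># rc a"
    using level_exchange_cut[OF U_eq short long, of A] that unfolding uncut cut val_le by blast
  show "\<exists>A'. A' \<subseteq># rc a \<and> tau_val n lam d (S(a := A)) \<le> tau_val n lam d (S(a := A'))"
    if "A \<subseteq># rc' a"
    using level_exchange_uncut[OF U_eq short long, of A] that unfolding uncut cut val_le by blast
qed

lemma tau_pos_hybrid:
  assumes a: "1 \<le> a" "a \<le> length ls" and lam: "lam \<subseteq># mset (butlast m)"
  shows "tau_pos n (hybrid a) lam d = tau_pos n (hybrid (Suc a)) lam d"
proof (rule antisym; rule tau_pos_leI)
  fix S assume S: "S \<in> choices n (hybrid a)"
  have S': "S c \<subseteq># (if c < a then rc' c else rc c)" if "1 \<le> c" "c \<le> n" for c
    using S that by (auto simp: choices_def hybrid_def)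
  have "1 < a \<Longrightarrow> S (a - 1) \<subseteq># rc' (a - 1)" "a < n \<Longrightarrow> S (a + 1) \<subseteq># rc (a + 1)" "S a \<subseteq># rc a"
    using S'[of "a - 1"] S'[of "a + 1"] S'[of a] a length_ls by (auto simp: less_Suc_eq_le)
  then obtain A' where A': "A' \<subseteq># rc' a"
      "tau_val n lam d (S(a := S a)) \<le> tau_val n lam d (S(a := A'))"
    using level_invariance(1)[OF a lam, of S "S a" d] by auto
  have "S(a := A') \<in> choices n (hybrid (Suc a))"
    using S A' a length_ls by (intro choices_update[OF S]) (auto simp: hybrid_def)
  with A' show "\<exists>S'\<in>choices n (hybrid (Suc a)). tau_val n lam d S \<le> tau_val n lam d S'"
    by auto
next
  fix S assume S: "S \<in> choices n (hybrid (Suc a))"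
  have S': "S c \<subseteq># (if c < Suc a then rc' c else rc c)" if "1 \<le> c" "c \<le> n" for c
    using S that by (auto simp: choices_def hybrid_def)
  have "1 < a \<Longrightarrow> S (a - 1) \<subseteq># rc' (a - 1)" "a < n \<Longrightarrow> S (a + 1) \<subseteq># rc (a + 1)" "S a \<subseteq># rc' a"
    using S'[of "a - 1"] S'[of "a + 1"] S'[of a] a length_ls by (auto simp: less_Suc_eq_le)
  then obtain A' where A': "A' \<subseteq># rc a"
      "tau_val n lam d (S(a := S a)) \<le> tau_val n lam d (S(a := A'))"
    using level_invariance(2)[OF a lam, of S "S a" d] by auto
  have "S(a := A') \<in> choices n (hybrid a)"
    using S A' a length_ls by (intro choices_update[OF S]) (auto simp: hybrid_def)
  with A' show "\<exists>S'\<in>choices n (hybrid a). tau_val n lam d S \<le> tau_val n lam d S'"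
    by auto
qed

lemma tau_step:
  assumes lam: "lam \<subseteq># mset (butlast m)"
  shows "tau n rc' lam d = tau n rc lam d"
proof -
  have "b \<le> Suc (length ls) \<Longrightarrow> tau_pos n (hybrid 1) lam d' = tau_pos n (hybrid b) lam d'"
    if "1 \<le> b" for b d'
    using that by (induction b rule: dec_induct) (auto simp: tau_pos_hybrid lam)
  then have "tau_pos n (hybrid 1) lam d' = tau_pos n (hybrid (Suc (length ls))) lam d'" for d'
    by simp
  moreover have "choices n (hybrid 1) = choices n rc"
    by (rule choices_cong) (auto simp: hybrid_def)
  moreover have "choices n (hybrid (Suc (length ls))) = choices n rc'"
    by (rule choices_cong) (auto simp: hybrid_def rc'_uncut)
  ultimately show ?thesis
    by (simp add: tau_def tau_pos_def)
qed

end

section \<open>Counting letters\<close>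

definition weight :: "nat \<Rightarrow> nat list \<Rightarrow> rcfg \<Rightarrow> nat \<Rightarrow> int" where
  "weight n m rc a = (if a = 0 then int (sum_list m)
    else if a \<le> n then int (sum_mset (shape rc a)) else 0)"

context box_removal
begin

lemma weight_step: "weight n m' rc' a = weight n m rc a - of_bool (a \<le> length ls)"
proof -
  consider "a = 0" | "1 \<le> a" "a \<le> length ls" | "length ls < a" by linarith
  then show ?thesis
  proof cases
    case 1
    have "m = butlast m @ [last m]" using nonempty by simp
    then have "sum_list m = sum_list (butlast m) + last m"
      by (metis sum_list.Cons sum_list.Nil sum_list_append add_0_right)
    then show ?thesis
      using last_pos by (simp add: 1 weight_def m'_def)
  next
    case 2
    then show ?thesis
      using length_ls ell_pos[of a] rc'_cut[of a] rc_split[of a]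
      by (auto simp: weight_def shape_def of_nat_diff)
  next
    case 3
    then show ?thesis by (simp add: weight_def rc'_uncut shape_def)
  qed
qed

end

text \<open>A step with \<open>L\<close> selected rows lowers the weights of levels \<open>0\<close>
  to \<open>L\<close>, so \<open>weight (d - 1) - weight d\<close> drops by one exactly when the
  output \<open>L + 1\<close> equals \<open>d\<close>. Summing over the steps telescopes.\<close>

lemma run_row_spec:
  assumes "valid n m rc" "m \<noteq> []" "c \<le> last m" "run_row n c (m, rc) = (ws, (m', rc'))"
  shows "m' = butlast m @ [last m - c]" and "valid n m' rc'"
    and "lam \<subseteq># mset (butlast m) \<Longrightarrow> tau n rc' lam d = tau n rc lam d"
    and "1 \<le> d \<Longrightarrow> int (count (mset ws) d) =
      (weight n m rc (d - 1) - weight n m rc d) - (weight n m' rc' (d - 1) - weight n m' rc' d)"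
proof -
  have "m' = butlast m @ [last m - c] \<and> valid n m' rc' \<and>
    (\<forall>lam d. lam \<subseteq># mset (butlast m) \<longrightarrow> tau n rc' lam d = tau n rc lam d) \<and>
    (\<forall>d\<ge>1. int (count (mset ws) d) =
      (weight n m rc (d - 1) - weight n m rc d) - (weight n m' rc' (d - 1) - weight n m' rc' d))"
    using assms
  proof (induction c arbitrary: m rc ws)
    case 0
    then show ?case by auto
  next
    case (Suc c)
    interpret box: box_removal n m rc
      using Suc.prems by unfold_locales auto
    obtain ws1 where ws1: "run_row n c (box.m', box.rc') = (ws1, (m', rc'))"
        "ws = Suc (length box.ls) # ws1"
      using Suc.prems(4) by (auto simp: box.step_eq split: prod.splits)
    have m': "box.m' \<noteq> []" "butlast box.m' = butlast m" "last box.m' = last m - 1"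
      by (auto simp: box.m'_def)
    have *: "c \<le> last box.m'" "box.m' \<noteq> []"
      using Suc.prems(3) m' by auto
    note IH0 = Suc.IH[OF box.valid_step *(2,1) ws1(1), unfolded m']
    have IH: "m' = butlast m @ [last m - 1 - c]" "valid n m' rc'"
      "\<And>lam d. lam \<subseteq># mset (butlast m) \<Longrightarrow> tau n rc' lam d = tau n box.rc' lam d"
      "\<And>d. 1 \<le> d \<Longrightarrow> int (count (mset ws1) d) =
        (weight n box.m' box.rc' (d - 1) - weight n box.m' box.rc' d) -
        (weight n m' rc' (d - 1) - weight n m' rc' d)"
      using IH0 by blast+
    have "int (count (mset ws) d) =
        (weight n m rc (d - 1) - weight n m rc d) - (weight n m' rc' (d - 1) - weight n m' rc' d)"
      if "1 \<le> d" for d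
      using that IH(4)[OF that] by (auto simp: ws1(2) box.weight_step)
    with IH box.tau_step show ?case by auto
  qed
  then show "m' = butlast m @ [last m - c]" and "valid n m' rc'"
    and "lam \<subseteq># mset (butlast m) \<Longrightarrow> tau n rc' lam d = tau n rc lam d"
    and "1 \<le> d \<Longrightarrow> int (count (mset ws) d) =
      (weight n m rc (d - 1) - weight n m rc d) - (weight n m' rc' (d - 1) - weight n m' rc' d)"
    by blast+
qed

section \<open>The tau function of the full configuration\<close>

text \<open>The triangular terms in \<open>h (Suc n)\<close> here and in \<open>h n\<close> below are what makes the induction go
  through: each step reduces to \<open>y * (y - 1) \<ge> 0\<close> for a difference \<open>y\<close> of neighbours.\<close>
lemma cartan_form_ge_aux:
  fixes h :: "nat \<Rightarrow> int"
  shows "h (Suc n) * (h (Suc n) + 1) \<le>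
    2 * ((\<Sum>a=1..Suc n. h a * h a) - (\<Sum>a=1..<Suc n. h a * h (a + 1)))"
proof (induction n)
  case 0
  have "h 1 \<le> h 1 * h 1" by (cases "h 1 \<le> 0") (auto simp: mult_le_cancel_left intro: order.trans)
  then show ?case by (simp add: algebra_simps)
next
  case (Suc n)
  define y where "y = h (Suc (Suc n)) - h (Suc n)"
  have "0 \<le> y * (y - 1)" by (cases "y \<le> 0") (auto simp: mult_nonpos_nonpos)
  with Suc show ?case by (simp add: y_def algebra_simps)
qed

lemma cartan_form_ge:
  fixes h :: "nat \<Rightarrow> int"
  assumes "1 \<le> d" "d \<le> n"
  shows "2 * h d + h n * (h n - 1) \<le>
    2 * ((\<Sum>a=1..n. h a * h a) - (\<Sum>a=1..<n. h a * h (a + 1)))"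
  using assms(2)
proof (induction n rule: dec_induct)
  case base
  \<comment> \<open>For \<open>n = d\<close> the left side is \<open>h d * (h d + 1)\<close>, the
    bound of the preceding lemma.\<close>
  obtain k where "d = Suc k" using assms(1) by (cases d) auto
  with cartan_form_ge_aux[of h k] show ?case by (simp add: algebra_simps)
next
  case (step n)
  define y where "y = h n - h (Suc n)"
  have "0 \<le> y * (y - 1)" by (cases "y \<le> 0") (auto simp: mult_nonpos_nonpos)
  with step assms(1) show ?case by (simp add: y_def algebra_simps)
qed

lemma cartan_form_ge':
  fixes h :: "nat \<Rightarrow> int"
  assumes "1 \<le> n" "1 \<le> d"
  shows "(if d \<le> n then h d else 0) \<le> (\<Sum>a=1..n. h a * h a) - (\<Sum>a=1..<n. h a * h (a + 1))"
proof -
  have pos: "0 \<le> x * (x + 1)" "0 \<le> x * (x - 1)" for x :: int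
    by (cases "x < 0"; simp add: mult_nonpos_nonpos; fail | cases "x \<le> 0"; simp add: mult_nonpos_nonpos)+
  obtain k where "n = Suc k" using assms(1) by (cases n) auto
  then show ?thesis
    using cartan_form_ge_aux[of h k] cartan_form_ge[of d n h] pos(1)[of "h n"] pos(2)[of "h n"] assms(2)
    by auto
qed

text \<open>The pairing is a sum over columns, so the Cartan bound is applied to the heights in each
  column; \<open>J\<close> bounds all row lengths involved.\<close>

lemma minm_cartan_ge:
  fixes n d :: nat
  assumes "1 \<le> n" "1 \<le> d"
  shows "(if d \<le> n then int (sum_mset (t d)) else 0) \<le>
    (\<Sum>a=1..n. minm (t a) (t a)) - (\<Sum>a=1..<n. minm (t a) (t (a + 1)))"
proof -
  define J where "J = Max (insert 0 (\<Union>a\<in>{1..n}. set_mset (t a)))"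
  have J: "\<forall>x\<in>#t a. x \<le> J" if "a \<in> {1..n}" for a
    unfolding J_def using that by (intro ballI Max_ge finite.insertI finite_UN_I) auto
  have "(\<Sum>i<J. (if d \<le> n then height (t d) (Suc i) else 0)) \<le>
      (\<Sum>i<J. (\<Sum>a=1..n. height (t a) (Suc i) * height (t a) (Suc i))
        - (\<Sum>a=1..<n. height (t a) (Suc i) * height (t (a + 1)) (Suc i)))"
    by (intro sum_mono cartan_form_ge' assms)
  also have "\<dots> = (\<Sum>a=1..n. \<Sum>i<J. height (t a) (Suc i) * height (t a) (Suc i))
      - (\<Sum>a=1..<n. \<Sum>i<J. height (t a) (Suc i) * height (t (a + 1)) (Suc i))"
    unfolding sum_subtractf by (intro arg_cong2[where f = "(-)"] sum.swap)
  also have "\<dots> = (\<Sum>a=1..n. minm (t a) (t a)) - (\<Sum>a=1..<n. minm (t a) (t (a + 1)))"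
    by (intro arg_cong2[where f = "(-)"] sum.cong refl minm_conv_sum_height [symmetric] J) auto
  also have "(\<Sum>i<J. (if d \<le> n then height (t d) (Suc i) else 0)) =
      (if d \<le> n then int (sum_mset (t d)) else 0)"
    using J[of d] sum_mset_conv_sum_height[of "t d" J] assms(2) by auto
  finally show ?thesis .
qed

lemma sum_shift_first:
  fixes g :: "nat \<Rightarrow> int"
  assumes "1 \<le> n"
  shows "(\<Sum>a=1..n. if a = 1 then x else g (a - 1)) = x + (\<Sum>a=1..<n. g a)"
  using assms by (induction n rule: dec_induct) auto

lemma sum_drop_last:
  fixes g :: "nat \<Rightarrow> int"
  assumes "1 \<le> n"
  shows "(\<Sum>a=1..n. if a < n then g a else 0) = (\<Sum>a=1..<n. g a)"
proof -
  have "{1..n} = insert n {1..<n}" using assms by auto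
  then show ?thesis by simp
qed

text \<open>The full configuration as a member of \<open>choices\<close>, whose members are empty
  off the levels \<open>1\<close> to \<open>n\<close>.\<close>

definition restrict_levels :: "nat \<Rightarrow> rcfg \<Rightarrow> rcfg" where
  "restrict_levels n rc a = (if a \<in> {1..n} then rc a else {#})"

text \<open>Bound the riggings of the left-out rows \<open>T\<close> by their vacancy numbers. All
  terms mixing \<open>s\<close> and \<open>t\<close> then cancel, and the full choice wins by at
  least the Cartan form of \<open>t\<close> minus the mass of \<open>t d\<close>, which is
  nonnegative.\<close>

lemma tau_val_le_full:
  assumes n: "1 \<le> n" and d: "1 \<le> d" and valid: "valid n m rc" and S: "S \<in> choices n rc"
  shows "tau_val n (mset m) d S \<le> tau_val n (mset m) d (restrict_levels n rc)"
proof -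
  define R where "R = restrict_levels n rc"
  define T where "T a = R a - S a" for a
  have R: "R a = S a + T a" for a
    using S by (auto simp: T_def R_def restrict_levels_def choices_def)
  define s t where "s = shape S" and "t = shape T"
  have shape_R: "image_mset fst (R a) = s a + t a" for a
    by (simp add: R s_def t_def shape_def)
  have rigging: "(\<Sum>x\<in>#T a. snd x) \<le> (\<Sum>x\<in>#t a. vac n m rc a x)" if a: "a \<in> {1..n}" for a
  proof -
    have "snd x \<le> vac n m rc a (fst x)" if "x \<in># T a" for x
    proof -
      have "x \<in># rc a"
        using that a by (auto simp: T_def R_def restrict_levels_def dest: in_diffD)
      with valid a show ?thesis by (force simp: valid_def)
    qed
    then show ?thesis
      by (simp add: t_def shape_def image_mset.compositionality comp_def sum_mset_mono)
  qed
  have vac_eq: "vac n m rc a x = (if a = 1 then Eshape (mset m) x else Eshape (s (a - 1) + t (a - 1)) x)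
      - 2 * Eshape (s a + t a) x + (if a < n then Eshape (s (a + 1) + t (a + 1)) x else 0)"
    if a: "a \<in> {1..n}" for a x
    using a shape_R[of a] shape_R[of "a - 1"] shape_R[of "a + 1"]
    by (cases a) (auto simp: vac_def Efun_def shape_def R_def restrict_levels_def Suc_le_eq)
  \<comment> \<open>The index \<open>a - 1 + 1\<close> presents the lower-neighbour term as a
    function of \<open>a - 1\<close>, as needed for \<open>sum_shift_first\<close>.\<close>
  have vac_sum: "(\<Sum>x\<in>#t a. vac n m rc a x) =
      (if a = 1 then minm (t 1) (mset m) else minm (t (a - 1 + 1)) (s (a - 1) + t (a - 1)))
      - 2 * minm (t a) (s a + t a) + (if a < n then minm (t a) (s (a + 1) + t (a + 1)) else 0)"
    if a: "a \<in> {1..n}" for a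
    unfolding minm_conv_sum_Eshape vac_eq[OF a] using a
    by (auto simp: sum_mset.distrib sum_mset_distrib_left algebra_simps simp del: Eshape_plus
        simp flip: sum_mset.distrib)
  have "(\<Sum>a=1..n. \<Sum>x\<in>#T a. snd x) \<le> (\<Sum>a=1..n. \<Sum>x\<in>#t a. vac n m rc a x)"
    by (intro sum_mono rigging)
  also have "\<dots> =
      (\<Sum>a=1..n. if a = 1 then minm (t 1) (mset m) else minm (t (a - 1 + 1)) (s (a - 1) + t (a - 1)))
      - 2 * (\<Sum>a=1..n. minm (t a) (s a + t a))
      + (\<Sum>a=1..n. if a < n then minm (t a) (s (a + 1) + t (a + 1)) else 0)"
    unfolding sum_distrib_left sum.distrib [symmetric] sum_subtractf [symmetric]
    by (intro sum.cong refl vac_sum)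
  also have "\<dots> = minm (t 1) (mset m) + (\<Sum>a=1..<n. minm (t (a + 1)) (s a + t a))
      - 2 * (\<Sum>a=1..n. minm (t a) (s a + t a)) + (\<Sum>a=1..<n. minm (t a) (s (a + 1) + t (a + 1)))"
    unfolding sum_drop_last[OF n]
      sum_shift_first[OF n, of _ "\<lambda>a. minm (t (a + 1)) (s a + t a)"] by (rule refl)
  finally have "(\<Sum>a=1..n. \<Sum>x\<in>#T a. snd x) \<le> \<dots>" .
  moreover have "(\<Sum>a=1..<n. minm (t (a + 1)) (s a + t a)) =
      (\<Sum>a=1..<n. minm (s a) (t (a + 1))) + (\<Sum>a=1..<n. minm (t a) (t (a + 1)))"
    by (simp add: sum.distrib minm_commute)
  moreover have "(\<Sum>a=1..n. minm (s a) (t a)) = (\<Sum>a=1..n. minm (t a) (s a))"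
    by (simp add: minm_commute)
  moreover have "minm (mset m) (t 1) = minm (t 1) (mset m)"
    by (rule minm_commute)
  ultimately show ?thesis
    using minm_cartan_ge[OF n d, of t]
    unfolding R_def [symmetric] tau_val_def Let_def shape_R s_def [symmetric]
    by (simp add: R sum.distrib shape_def [symmetric] s_def [symmetric] split: if_splits)
qed

text \<open>At the full choice, changing \<open>d\<close> changes only the subtracted mass.
  Including \<open>d = 0\<close> is consistent because \<open>weight\<close> at \<open>0\<close> is
  \<open>|lam|\<close> and at \<open>n + 1\<close> is \<open>0\<close>.\<close>

lemma tau_full:
  assumes n: "1 \<le> n" and valid: "valid n m rc" and d: "d \<le> n + 1"
  shows "tau n rc (mset m) d =
    tau_val n (mset m) (n + 1) (restrict_levels n rc) - weight n m rc d"
proof -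
  have "tau_pos n rc (mset m) d = tau_val n (mset m) d (restrict_levels n rc)" if "1 \<le> d" for d
    unfolding tau_pos_def
  proof (rule Max_eqI)
    show "tau_val n (mset m) d (restrict_levels n rc) \<in> tau_val n (mset m) d ` choices n rc"
      by (intro imageI) (simp add: choices_def restrict_levels_def)
  qed (use tau_val_le_full[OF n that valid] in \<open>auto simp: finite_choices\<close>)
  moreover have "tau_val n (mset m) d (restrict_levels n rc) =
      tau_val n (mset m) (n + 1) (restrict_levels n rc) - weight n m rc d" if "1 \<le> d"
    using that d by (auto simp: tau_val_def Let_def weight_def shape_def restrict_levels_def)
  ultimately show ?thesis
    by (auto simp: tau_def weight_def sum_mset_sum_list)
qed

section \<open>Processing the rows from the last to the first\<close>

lemma kkr_rows_count:
  assumes n: "1 \<le> n" and d: "1 \<le> d" "d \<le> n + 1"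
    and "valid n m rc" "1 \<le> k" "k \<le> length m"
  shows "int (count (mset (kkr_rows n (length m) (m, rc) ! (k - 1))) d) =
    tauk n m rc k d - tauk n m rc (k - 1) d - tauk n m rc k (d - 1) + tauk n m rc (k - 1) (d - 1)"
  using assms(4-6)
proof (induction "length m" arbitrary: m rc)
  case (Suc K)
  obtain ws m' rc' where run: "run_row n (m ! K) (m, rc) = (ws, (m', rc'))"
    by (metis prod.exhaust)
  have "m \<noteq> []" using Suc.hyps(2) by auto
  then have last: "m ! K = last m" and bl: "butlast m = take K m"
    using Suc.hyps(2) by (simp_all add: last_conv_nth butlast_conv_take flip: Suc.hyps(2))
  note row = run_row_spec[OF Suc.prems(1) \<open>m \<noteq> []\<close> _ run, unfolded last bl, simplified]
  have lengths: "length (take K m) = K" using Suc.hyps(2) by simp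
  have take: "take K m' = take K m" using row(1) lengths by simp
  have vac: "vac n (take K m) rc' = vac n m' rc'"
    by (simp add: fun_eq_iff vac_def Efun_def row(1))
  have weight: "weight n (take K m) rc' = weight n m' rc'"
    by (simp add: fun_eq_iff weight_def row(1))
  have valid': "valid n (take K m) rc'"
    using row(2) by (simp add: valid_def vac)
  have tauk: "tauk n (take K m) rc' j e = tauk n m rc j e" if "j \<le> K" for j e
  proof -
    have "take j m = take j (take K m)" using that by simp
    then have "mset (take j m) \<subseteq># mset (take K m)"
      by (metis append_take_drop_id mset_append mset_subset_eq_add_left)
    then show ?thesis
      using row(3) that by (simp add: tauk_def min_absorb1)
  qed
  have rows: "kkr_rows n (Suc K) (m, rc) = kkr_rows n K (take K m, rc') @ [ws]"
    by (simp add: run take)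
  have length_rows: "length (kkr_rows n j st) = j" for j st
    by (induction j arbitrary: st) (simp_all add: split_beta)
  show ?case
  proof (cases "k = Suc K")
    case True
    \<comment> \<open>Invariance turns the tau function of the first \<open>K\<close> rows into that
      of the full configuration after the row is processed. The constants independent of
      \<open>e\<close> cancel between \<open>d\<close> and \<open>d - 1\<close>, leaving the weights
      counted by \<open>run_row_spec\<close>.\<close>
    have "tauk n m rc K e = tau_val n (mset (take K m)) (n + 1) (restrict_levels n rc') - weight n m' rc' e"
      if "e \<le> n + 1" for e
      using tauk[of K e] tau_full[OF n valid' that] by (simp add: tauk_def weight)
    moreover have "tauk n m rc (Suc K) e = tau_val n (mset m) (n + 1) (restrict_levels n rc) - weight n m rc e"
      if "e \<le> n + 1" for e
      using tau_full[OF n Suc.prems(1) that] Suc.hyps(2) by (simp add: tauk_def)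
    ultimately show ?thesis
      using row(4)[of d] d True unfolding Suc.hyps(2)[symmetric] rows by (simp add: nth_append length_rows)
  next
    case False
    then have "k \<le> K" "k - 1 < K" using Suc.prems(2,3) Suc.hyps(2) by auto
    then show ?thesis
      using Suc.hyps(1)[of "take K m" rc'] Suc.prems(2) lengths valid' tauk
      unfolding Suc.hyps(2)[symmetric] rows by (simp add: nth_append length_rows)
  qed
qed simp

theorem theorem2p1:
  fixes n :: nat and m :: "nat list" and rc :: rcfg and k d :: nat
  assumes "1 \<le> n" and "is_rc n m rc"
    and "1 \<le> k" and "k \<le> length m" and "1 \<le> d" and "d \<le> n + 1"
  shows "int (kkr_x n m rc k d) =
           tauk n m rc k d - tauk n m rc (k - 1) d - tauk n m rc k (d - 1)
           + tauk n m rc (k - 1) (d - 1)"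
proof -
  have "valid n m rc"
    using assms(2) by (auto simp: is_rc_def valid_def)
  then show ?thesis
    unfolding kkr_x_def kkr_def using assms by (intro kkr_rows_count)
qed

end
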